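(* Let $\mathcal{A}=\{(H_i,u_i)\}_{i=1}^d$ be a smooth oriented hyperplane arrangement in $\mathfrak{n}^*$, $H_i=\{x\in\mathfrak{n}^*\mid \langle u_i,x\rangle+\lambda_i=0\}$, and let $\alpha=\sum_{i=1}^d\lambda_i\,\iota^*e_i^*\in\mathfrak{m}^*$ be the associated moment map value (with $\mathfrak m$, $\mathfrak n$, $\iota$ as in the context). Then a point $z\in\mathbb{C}^d$ is $\alpha$-semi-stable if and only if the set $St_{\mathcal{A}}(z)\subset\mathfrak{n}^*$ is nonempty.
   Context: Let $T^d$ be the real $d$-torus acting on $\mathbb{C}^d$ by coordinatewise multiplication, with Lie algebra $\mathfrak{t}\cong\mathbb{R}^d$, standard basis $e_1,\dots,e_d$ and dual basis $e_1^*,\dots,e_d^*$. Let $M\subset T^d$ be a connected $m$-dimensional subtorus with Lie algebra $\mathfrak{m}$, $N=T^d/M$ with Lie algebra $\mathfrak{n}=\mathfrak{t}/\mathfrak{m}$ of dimension $n=d-m$. There are exact sequences $0\to\mathfrak{m}\xrightarrow{\iota}\mathfrak{t}\xrightarrow{\pi}\mathfrak{n}\to0$ and $0\to\mathfrak{n}^*\xrightarrow{\pi^*}\mathfrak{t}^*\xrightarrow{\iota^*}\mathfrak{m}^*\to0$. Put $u_i=\pi(e_i)$, assumed to be primitive vectors of the lattice $\mathfrak{n}_{\mathbb{Z}}=\pi(\mathbb{Z}^d)$. Given $\alpha\in\mathfrak{m}^*$, a lift of $\alpha$ is $\lambda=(\lambda_1,\dots,\lambda_d)\in\mathbb{R}^d$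 with $\alpha=\sum_i\lambda_i\iota^*e_i^*$. It defines $H_i=\{x\in\mathfrak{n}^*\mid\langle u_i,x\rangle+\lambda_i=0\}$ and $H_i^{\ge0}=\{x\in\mathfrak{n}^*\mid\langle u_i,x\rangle+\lambda_i\ge0\}$; different lifts give arrangements differing by a translation. The arrangement $\mathcal{A}$ is smooth if it is regular (every $n$ linearly independent vectors among the $u_i$ form a $\mathbb{Z}$-basis of $\mathfrak{n}_{\mathbb{Z}}$) and simple (every $k$ of the hyperplanes with nonempty intersection intersect in codimension $k$). For $z\in\mathbb{C}^d$ set $F_z(i)=H_i^{\ge0}$ if $z_i\ne0$ and $F_z(i)=H_i$ if $z_i=0$, and $St_{\mathcal{A}}(z)=\bigcap_{i=1}^dF_z(i)$. Semi-stability: for $\alpha\in\mathfrak{m}^*$, $z\in\mathbb{C}^d$ is $\alpha$-semi-stable if $\alpha\in\sum_{i=1}^d\mathbb{R}_{\ge0}|z_i|^2\,\iota^*e_i^*$. (For integral $\alpha\in\mathfrak{m}^*_{\mathbb{Z}}$ this is equivalent to GIT semi-stability: there are an integer $k>0$ and a polynomial $f$ on $\mathbb{C}^d$ with $f(p\zeta)=f(p)\chi_\alpha(\zeta)^k$ for all $\zeta\in M_{\mathbb{C}}$, $p\in\mathbb{C}^d$, and $f(z)\ne0$, where $\chi_\alpha$ is the character of the complexified torus $M_{\mathbb{C}}$ induced by $\alpha$.) *)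

theory Defs
  imports "HOL-Analysis.Analysis"
begin

text \<open>The torus is the group of vectors of unit complex numbers under componentwise
  multiplication; a subtorus is a closed connected subgroup. The exponential map is normalised as
  \<open>v \<mapsto> (exp (2 pi \<i> v\<^sub>i))\<^sub>i\<close>, so that its kernel is the standard lattice.\<close>

definition torus :: "(complex ^ 'd) set" where
  "torus = {t. \<forall>i. norm (t $ i) = 1}"

definition subtorus :: "(complex ^ 'd) set \<Rightarrow> bool" where
  "subtorus M \<longleftrightarrow> M \<subseteq> torus \<and> closed M \<and> connected M \<and> 1 \<in> M \<and>
     (\<forall>s\<in>M. \<forall>t\<in>M. s * t \<in> M) \<and> (\<forall>t\<in>M. (\<chi> i. inverse (t $ i)) \<in> M)"

definition torus_exp :: "real ^ 'd \<Rightarrow> complex ^ 'd" where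
  "torus_exp v = (\<chi> i. cis (2 * pi * v $ i))"

definition lie_algebra :: "(complex ^ 'd) set \<Rightarrow> (real ^ 'd) set" where
  "lie_algebra M = {v. \<forall>s::real. torus_exp (s *\<^sub>R v) \<in> M}"

text \<open>The spaces \<open>\<mm>\<close> and \<open>\<nn> = \<tt>/\<mm>\<close> are given by types \<open>'m\<close> and \<open>'n\<close> together with the maps of
  the exact sequence, which determines them up to isomorphism. The class
  \<open>real_normed_vector\<close> is used (rather than \<open>euclidean_space\<close>) because it admits the zero
  space, and it makes the dual spaces available as types of bounded linear functionals;
  finite-dimensionality is a consequence of exactness.\<close>

definition lie_exact_sequence ::
  "(complex ^ 'd) set \<Rightarrow> ('m::real_normed_vector \<Rightarrow>\<^sub>L (real ^ 'd)) \<Rightarrow>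
   ((real ^ 'd) \<Rightarrow>\<^sub>L 'n::real_normed_vector) \<Rightarrow> bool" where
  "lie_exact_sequence M \<iota> \<pi> \<longleftrightarrow>
     inj (blinfun_apply \<iota>) \<and> range (blinfun_apply \<iota>) = lie_algebra M \<and>
     {v. blinfun_apply \<pi> v = 0} = lie_algebra M \<and> surj (blinfun_apply \<pi>)"

definition dual_map ::
  "('a::real_normed_vector \<Rightarrow>\<^sub>L 'b::real_normed_vector) \<Rightarrow> ('b \<Rightarrow>\<^sub>L real) \<Rightarrow> ('a \<Rightarrow>\<^sub>L real)" where
  "dual_map T f = f o\<^sub>L T"

definition dual_basis :: "'d \<Rightarrow> ((real ^ 'd) \<Rightarrow>\<^sub>L real)" where
  "dual_basis i = Blinfun (\<lambda>v. v $ i)"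

lemma dual_basis_apply [simp]: "blinfun_apply (dual_basis i) v = v $ i"
  by (simp add: dual_basis_def bounded_linear_Blinfun_apply bounded_linear_vec_nth)

definition normal_vec :: "((real ^ 'd) \<Rightarrow>\<^sub>L 'n::real_normed_vector) \<Rightarrow> 'd \<Rightarrow> 'n" where
  "normal_vec \<pi> i = blinfun_apply \<pi> (axis i 1)"

definition quotient_lattice :: "((real ^ 'd) \<Rightarrow>\<^sub>L 'n::real_normed_vector) \<Rightarrow> 'n set" where
  "quotient_lattice \<pi> = blinfun_apply \<pi> ` {v. \<forall>i. v $ i \<in> \<int>}"

text \<open>The zero vector is not primitive, since \<open>0 = 0 \<cdot> 0\<close>.\<close>

definition primitive_vector :: "'a::real_vector set \<Rightarrow> 'a \<Rightarrow> bool" where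
  "primitive_vector L u \<longleftrightarrow>
     u \<in> L \<and> (\<forall>v\<in>L. \<forall>k::int. u = of_int k *\<^sub>R v \<longrightarrow> \<bar>k\<bar> = 1)"

definition int_scale :: "int \<Rightarrow> 'a::real_vector \<Rightarrow> 'a" where
  "int_scale k v = of_int k *\<^sub>R v"

lemma module_int_scale: "module (int_scale :: int \<Rightarrow> 'a::real_vector \<Rightarrow> 'a)"
  by unfold_locales (simp_all add: int_scale_def algebra_simps)

definition Z_basis :: "'a::real_vector set \<Rightarrow> 'a set \<Rightarrow> bool" where
  "Z_basis B L \<longleftrightarrow> \<not> module.dependent int_scale B \<and> module.span int_scale B = L"

definition hyperplane ::
  "('d \<Rightarrow> 'n::real_normed_vector) \<Rightarrow> real ^ 'd \<Rightarrow> 'd \<Rightarrow> ('n \<Rightarrow>\<^sub>L real) set" where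
  "hyperplane u l i = {x. blinfun_apply x (u i) + l $ i = 0}"

definition halfspace ::
  "('d \<Rightarrow> 'n::real_normed_vector) \<Rightarrow> real ^ 'd \<Rightarrow> 'd \<Rightarrow> ('n \<Rightarrow>\<^sub>L real) set" where
  "halfspace u l i = {x. blinfun_apply x (u i) + l $ i \<ge> 0}"

text \<open>Codimension of a nonempty affine subspace, through its direction space.\<close>

definition affine_codim :: "'a::real_vector set \<Rightarrow> nat" where
  "affine_codim S = dim (UNIV :: 'a set) - dim {x - y | x y. x \<in> S \<and> y \<in> S}"

definition regular_arrangement :: "'n::real_normed_vector set \<Rightarrow> ('d \<Rightarrow> 'n) \<Rightarrow> bool" where
  "regular_arrangement L u \<longleftrightarrow>
     (\<forall>B \<subseteq> range u. independent B \<and> card B = dim (UNIV :: 'n set) \<longrightarrow> Z_basis B L)"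

text \<open>The arrangement is an indexed family: coinciding hyperplanes with different indices count
  as different members.\<close>

definition simple_arrangement ::
  "('d::finite \<Rightarrow> 'n::real_normed_vector) \<Rightarrow> real ^ 'd \<Rightarrow> bool" where
  "simple_arrangement u l \<longleftrightarrow>
     (\<forall>I. (\<Inter>i\<in>I. hyperplane u l i) \<noteq> {} \<longrightarrow>
        affine_codim (\<Inter>i\<in>I. hyperplane u l i) = card I)"

definition smooth_arrangement ::
  "'n::real_normed_vector set \<Rightarrow> ('d::finite \<Rightarrow> 'n) \<Rightarrow> real ^ 'd \<Rightarrow> bool" where
  "smooth_arrangement L u l \<longleftrightarrow> regular_arrangement L u \<and> simple_arrangement u l"

definition face ::
  "('d \<Rightarrow> 'n::real_normed_vector) \<Rightarrow> real ^ 'd \<Rightarrow> complex ^ 'd \<Rightarrow> 'd \<Rightarrow> ('n \<Rightarrow>\<^sub>L real) set" where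
  "face u l z i = (if z $ i \<noteq> 0 then halfspace u l i else hyperplane u l i)"

definition St ::
  "('d \<Rightarrow> 'n::real_normed_vector) \<Rightarrow> real ^ 'd \<Rightarrow> complex ^ 'd \<Rightarrow> ('n \<Rightarrow>\<^sub>L real) set" where
  "St u l z = (\<Inter>i. face u l z i)"

definition semistable ::
  "('m::real_normed_vector \<Rightarrow>\<^sub>L (real ^ 'd)) \<Rightarrow> ('m \<Rightarrow>\<^sub>L real) \<Rightarrow> complex ^ 'd \<Rightarrow> bool" where
  "semistable \<iota> \<alpha> z \<longleftrightarrow>
     \<alpha> \<in> {\<Sum>i\<in>UNIV. (c i * (norm (z $ i))\<^sup>2) *\<^sub>R dual_map \<iota> (dual_basis i) | c. \<forall>i. c i \<ge> 0}"

end

theory Submission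
  imports Defs
begin

text \<open>Semi-stability asks for a lift of \<open>\<alpha>\<close> of the form \<open>i \<mapsto> c\<^sub>i |z\<^sub>i|\<^sup>2\<close> with \<open>c \<ge> 0\<close>, that is, a
  lift whose entries are nonnegative and vanish wherever \<open>z\<^sub>i = 0\<close>. By exactness of the dual
  sequence \<open>\<nn>\<^sup>* \<rightarrow> \<tt>\<^sup>* \<rightarrow> \<mm>\<^sup>*\<close>, the lifts of \<open>\<alpha>\<close> are exactly the vectors
  \<open>i \<mapsto> \<langle>u\<^sub>i, x\<rangle> + \<lambda>\<^sub>i\<close> with \<open>x \<in> \<nn>\<^sup>*\<close>, since \<open>\<pi>\<^sup>* x = \<Sum>\<^sub>i \<langle>u\<^sub>i, x\<rangle> e\<^sub>i\<^sup>*\<close>. The condition on such a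
  lift says precisely that \<open>x\<close> lies in the set \<open>H\<^sub>i\<^bsup>\<ge>0\<^esup>\<close> or \<open>H\<^sub>i\<close> prescribed by \<open>z\<^sub>i\<close>, for every \<open>i\<close>,
  so the lifts witnessing semi-stability correspond to the points of \<open>St(z)\<close>.

  The substance is exactness at \<open>\<tt>\<^sup>*\<close>, lemma \<open>dual_maps_eq_iff\<close>: a functional on \<open>\<tt>\<close>
  vanishing on \<open>ker \<pi>\<close> descends to \<open>\<nn>\<close>. As \<open>\<nn>\<^sup>*\<close> consists of bounded functionals on a
  normed space, continuity of the descended functional has to be shown; it comes from
  compactness of the unit sphere in the orthogonal complement of \<open>ker \<pi>\<close>.\<close>

text \<open>On the orthogonal complement of its kernel \<open>T\<close> is injective, so \<open>norm (T v)\<close> attains a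
  positive minimum on the compact unit sphere there; every vector may be moved into the
  complement without changing either side of the estimate.\<close>

lemma vanishing_on_kernel_bound:
  fixes T :: "'a::euclidean_space \<Rightarrow>\<^sub>L 'b::real_normed_vector"
    and g :: "'a \<Rightarrow>\<^sub>L 'c::real_normed_vector"
  assumes ker: "\<And>v. T v = 0 \<Longrightarrow> g v = 0"
  shows "\<exists>C. \<forall>v. norm (g v) \<le> C * norm (T v)"
proof -
  let ?K = "{v. T v = 0}"
  let ?S = "sphere 0 1 \<inter> (\<Inter>k\<in>?K. {v. k \<bullet> v = 0})"
  have subK: "subspace ?K"
    by (auto simp: subspace_def blinfun.add_right blinfun.scaleR_right)
  have "compact ?S"
    by (intro compact_Int_closed compact_sphere closed_INT ballI closed_hyperplane)
  have "\<exists>e>0. \<forall>v\<in>?S. e \<le> norm (T v)"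
  proof (cases "?S = {}")
    case True
    then show ?thesis by (metis empty_iff zero_less_one)
  next
    case False
    have "continuous_on ?S (\<lambda>v. norm (T v))"
      by (intro continuous_intros)
    with continuous_attains_inf[OF \<open>compact ?S\<close> False]
    obtain s where s: "s \<in> ?S" "\<forall>v\<in>?S. norm (T s) \<le> norm (T v)"
      by blast
    have "T s \<noteq> 0"
    proof
      assume "T s = 0"
      with s(1) have "s \<bullet> s = 0" by blast
      with s(1) show False by simp
    qed
    with s(2) show ?thesis by (intro exI[of _ "norm (T s)"]) auto
  qed
  then obtain e where e: "e > 0" "\<And>v. v \<in> ?S \<Longrightarrow> e \<le> norm (T v)"
    by blast
  have "norm (g v) \<le> norm g / e * norm (T v)" for v
  proof -
    obtain k w where k: "k \<in> span ?K" and w: "\<And>y. y \<in> span ?K \<Longrightarrow> orthogonal w y"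
      and v: "v = k + w"
      using orthogonal_subspace_decomp_exists[of ?K v] by blast
    have "T k = 0"
      using k subK by (simp add: span_eq_iff[THEN iffD2])
    then have Tv: "T v = T w" and gv: "g v = g w"
      using ker[of k] by (simp_all add: v blinfun.add_right)
    have "e * norm w \<le> norm (T w)"
    proof (cases "w = 0")
      case False
      have "(1 / norm w) *\<^sub>R w \<in> ?S"
        using False w by (auto simp: orthogonal_def inner_commute span_base)
      from e(2)[OF this] False show ?thesis
        by (simp add: blinfun.scaleR_right field_simps)
    qed simp
    then have "norm w \<le> norm (T w) / e"
      using e(1) by (simp add: field_simps)
    then have "norm g * norm w \<le> norm g * (norm (T w) / e)"
      by (rule mult_left_mono) simp
    with norm_blinfun[of g w] show ?thesis
      by (simp add: Tv gv)
  qed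
  then show ?thesis by blast
qed

lemma blinfun_factor_through_surj:
  fixes T :: "'a::euclidean_space \<Rightarrow>\<^sub>L 'b::real_normed_vector"
    and g :: "'a \<Rightarrow>\<^sub>L 'c::real_normed_vector"
  assumes surj: "surj (blinfun_apply T)"
    and ker: "\<And>v. T v = 0 \<Longrightarrow> g v = 0"
  shows "\<exists>x. g = x o\<^sub>L T"
proof -
  define r where "r = inv (blinfun_apply T)"
  have Tr: "T (r y) = y" for y
    unfolding r_def using surj by (rule surj_f_inv_f)
  \<comment> \<open>\<open>r\<close> is an arbitrary section; \<open>g\<close> takes the same value on all preimages of a point, which
    makes \<open>g \<circ> r\<close> linear although \<open>r\<close> may not be.\<close>
  have well: "g v = g w" if "T v = T w" for v w
    using ker[of "v - w"] that by (simp add: blinfun.diff_right)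
  obtain C where C: "\<And>v. norm (g v) \<le> C * norm (T v)"
    using vanishing_on_kernel_bound[OF ker] by blast
  have "bounded_linear (\<lambda>y. g (r y))"
  proof (rule bounded_linear_intro)
    show "g (r (y + y')) = g (r y) + g (r y')" for y y'
      using well[of "r (y + y')" "r y + r y'"] by (simp add: Tr blinfun.add_right)
    show "g (r (a *\<^sub>R y)) = a *\<^sub>R g (r y)" for a y
      using well[of "r (a *\<^sub>R y)" "a *\<^sub>R r y"] by (simp add: Tr blinfun.scaleR_right)
    show "norm (g (r y)) \<le> norm y * C" for y
      using C[of "r y"] by (simp add: Tr mult.commute)
  qed
  then have "blinfun_apply (Blinfun (\<lambda>y. g (r y))) (T v) = g v" for v
    using well[of "r (T v)" v] by (simp add: bounded_linear_Blinfun_apply Tr)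
  then show ?thesis
    by (intro exI[of _ "Blinfun (\<lambda>y. g (r y))"] blinfun_eqI) simp
qed

lemma sum_dual_map_apply:
  fixes \<iota> :: "'m::real_normed_vector \<Rightarrow>\<^sub>L (real ^ 'd)"
  shows "(\<Sum>i\<in>UNIV. a i *\<^sub>R dual_map \<iota> (dual_basis i)) w = (\<Sum>i\<in>UNIV. a i * \<iota> w $ i)"
  by (simp add: blinfun.sum_left blinfun.scaleR_left dual_map_def)

lemma apply_eq_sum_normal_vec:
  fixes \<pi> :: "(real ^ 'd) \<Rightarrow>\<^sub>L 'n::real_normed_vector"
  shows "\<pi> v = (\<Sum>i\<in>UNIV. v $ i *\<^sub>R normal_vec \<pi> i)"
proof -
  have "\<pi> v = \<pi> (\<Sum>i\<in>UNIV. v $ i *\<^sub>R axis i 1)"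
    using basis_expansion[of v] by (simp add: scalar_mult_eq_scaleR)
  then show ?thesis
    by (simp add: blinfun.sum_right blinfun.scaleR_right normal_vec_def)
qed

text \<open>Exactness of \<open>\<nn>\<^sup>* \<rightarrow> \<tt>\<^sup>* \<rightarrow> \<mm>\<^sup>*\<close> at \<open>\<tt>\<^sup>*\<close> in coordinates: two vectors lift the same
  functional on \<open>\<mm>\<close> iff their difference is \<open>\<pi>\<^sup>* x\<close> for some \<open>x\<close>.\<close>

lemma dual_maps_eq_iff:
  fixes \<iota> :: "'m::real_normed_vector \<Rightarrow>\<^sub>L (real ^ 'd)"
    and \<pi> :: "(real ^ 'd) \<Rightarrow>\<^sub>L 'n::real_normed_vector"
  assumes exact: "range (blinfun_apply \<iota>) = {v. \<pi> v = 0}"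
    and surj: "surj (blinfun_apply \<pi>)"
  shows "(\<Sum>i\<in>UNIV. a i *\<^sub>R dual_map \<iota> (dual_basis i))
       = (\<Sum>i\<in>UNIV. b i *\<^sub>R dual_map \<iota> (dual_basis i))
     \<longleftrightarrow> (\<exists>x. \<forall>i. blinfun_apply x (normal_vec \<pi> i) + b i = a i)" (is "?A = ?B \<longleftrightarrow> ?R")
proof
  assume eq: "?A = ?B"
  define g :: "(real ^ 'd) \<Rightarrow>\<^sub>L real" where "g = (\<Sum>i\<in>UNIV. (a i - b i) *\<^sub>R dual_basis i)"
  have g: "g v = (\<Sum>i\<in>UNIV. (a i - b i) * v $ i)" for v
    by (simp add: g_def blinfun.sum_left blinfun.scaleR_left)
  have "g v = 0" if "\<pi> v = 0" for v
  proof -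
    have "v \<in> range (blinfun_apply \<iota>)"
      unfolding exact using that by simp
    then obtain w where w: "v = \<iota> w" by (rule rangeE)
    have "?A w = ?B w" using eq by simp
    then show ?thesis
      by (simp add: g w sum_dual_map_apply left_diff_distrib sum_subtractf)
  qed
  with blinfun_factor_through_surj[OF surj]
  obtain x where x: "g = x o\<^sub>L \<pi>" by blast
  have "x (normal_vec \<pi> i) = a i - b i" for i
  proof -
    have "x (normal_vec \<pi> i) = g (axis i 1)"
      by (simp add: x normal_vec_def)
    also have "\<dots> = a i - b i"
      by (simp add: g axis_def if_distrib cong: if_cong)
    finally show ?thesis .
  qed
  then show ?R by (intro exI[of _ x]) simp
next
  assume ?R
  then obtain x :: "'n \<Rightarrow>\<^sub>L real" where "\<forall>i. x (normal_vec \<pi> i) + b i = a i" ..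
  then have x: "a i = x (normal_vec \<pi> i) + b i" for i by simp
  show "?A = ?B"
  proof (rule blinfun_eqI)
    fix w
    have "\<iota> w \<in> {v. \<pi> v = 0}" unfolding exact[symmetric] by (rule rangeI)
    then have "\<pi> (\<iota> w) = 0" by simp
    then have "x (\<Sum>i\<in>UNIV. \<iota> w $ i *\<^sub>R normal_vec \<pi> i) = 0"
      by (simp flip: apply_eq_sum_normal_vec)
    then have "(\<Sum>i\<in>UNIV. x (normal_vec \<pi> i) * \<iota> w $ i) = 0"
      by (simp add: blinfun.sum_right blinfun.scaleR_right mult.commute)
    then show "?A w = ?B w"
      unfolding sum_dual_map_apply by (simp add: x distrib_right sum.distrib)
  qed
qed

lemma mem_face_iff:
  "x \<in> face u l z i \<longleftrightarrow> (\<exists>c\<ge>0. x (u i) + l $ i = c * (norm (z $ i))\<^sup>2)"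
proof (cases "z $ i = 0")
  case True
  then show ?thesis by (auto simp: face_def hyperplane_def)
next
  case False
  have "(\<exists>c\<ge>0. y = c * (norm (z $ i))\<^sup>2) \<longleftrightarrow> y \<ge> 0" for y :: real
    using False by (auto intro!: exI[of _ "y / (norm (z $ i))\<^sup>2"])
  with False show ?thesis by (simp add: face_def halfspace_def)
qed

theorem proposition1p1:
  fixes M :: "(complex ^ 'd) set"
    and \<iota> :: "'m::real_normed_vector \<Rightarrow>\<^sub>L (real ^ 'd)"
    and \<pi> :: "(real ^ 'd) \<Rightarrow>\<^sub>L 'n::real_normed_vector"
    and l :: "real ^ 'd"
    and \<alpha> :: "'m \<Rightarrow>\<^sub>L real"
    and z :: "complex ^ 'd"
  assumes "subtorus M"
    and "lie_exact_sequence M \<iota> \<pi>"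
    and "\<forall>i. primitive_vector (quotient_lattice \<pi>) (normal_vec \<pi> i)"
    and "smooth_arrangement (quotient_lattice \<pi>) (normal_vec \<pi>) l"
    and "\<alpha> = (\<Sum>i\<in>UNIV. (l $ i) *\<^sub>R dual_map \<iota> (dual_basis i))"
  shows "semistable \<iota> \<alpha> z \<longleftrightarrow> St (normal_vec \<pi>) l z \<noteq> {}"
proof -
  have exact: "range (blinfun_apply \<iota>) = {v. \<pi> v = 0}" and surj: "surj (blinfun_apply \<pi>)"
    using assms(2) by (auto simp: lie_exact_sequence_def)
  let ?n = "\<lambda>i. (norm (z $ i))\<^sup>2"
  have "semistable \<iota> \<alpha> z \<longleftrightarrow>
      (\<exists>c. (\<forall>i. c i \<ge> 0) \<and> (\<Sum>i\<in>UNIV. (c i * ?n i) *\<^sub>R dual_map \<iota> (dual_basis i)) = \<alpha>)"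
    by (auto simp: semistable_def)
  also have "\<dots> \<longleftrightarrow> (\<exists>c. (\<forall>i. c i \<ge> 0) \<and>
      (\<exists>x. \<forall>i. blinfun_apply x (normal_vec \<pi> i) + l $ i = c i * ?n i))"
    unfolding assms(5) dual_maps_eq_iff[OF exact surj] ..
  also have "\<dots> \<longleftrightarrow> (\<exists>x. \<forall>i. \<exists>c\<ge>0. blinfun_apply x (normal_vec \<pi> i) + l $ i = c * ?n i)"
    unfolding choice_iff by blast
  also have "\<dots> \<longleftrightarrow> St (normal_vec \<pi>) l z \<noteq> {}"
    unfolding St_def ex_in_conv[symmetric] INT_iff mem_face_iff by simp
  finally show ?thesis .
qed

end
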